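(* $${}_2F_1\left(\tfrac35,\tfrac45;\tfrac9{10};\tfrac{3}{128}\right)=\frac{8}{75}\,\sqrt2\,\sqrt[10]{3}\,\sqrt5\,\sqrt{5+\sqrt5}.$$
   Context: For complex $a,b,c$ with $c\notin\{0,-1,-2,\dots\}$ and $|x|<1$, ${}_2F_1(a,b;c;x)=\sum_{n\ge 0}\frac{(a,n)(b,n)}{(c,n)(1,n)}x^n$ denotes Gauss's hypergeometric series, where $(\alpha,n)=\alpha(\alpha+1)\cdots(\alpha+n-1)$, $(\alpha,0)=1$. All roots are positive real roots. *)

theory Defs
  imports "HOL-Analysis.Analysis"
begin

text \<open>
  Only meaningful when \<open>c\<close> is not a non-positive integer and \<open>norm x < 1\<close>:
  otherwise terms are divided by zero or \<open>suminf\<close> may be applied to a divergent series.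
\<close>

definition hyp2F1 :: "complex \<Rightarrow> complex \<Rightarrow> complex \<Rightarrow> complex \<Rightarrow> complex" where
  "hyp2F1 a b c x =
     (\<Sum>n. pochhammer a n * pochhammer b n / (pochhammer c n * pochhammer 1 n) * x ^ n)"

lemma hyp2F1_eq_eval_fps: "hyp2F1 a b c x = eval_fps (fps_hypergeo [a, b] [c] 1) x"
  by (simp add: hyp2F1_def eval_fps_def flip: pochhammer_fact)

end

theory Submission
  imports Defs
begin

text \<open>
  Put \<open>x = 3/128\<close>, \<open>r = 3/8\<close> and \<open>\<kappa> = 3\<^sup>3 5\<^sup>5 / 2\<^sup>1\<^sup>6\<close>. There is a cubic polynomial \<open>C\<close> with
  \<open>(1 - x t) (1 - r t)\<^sup>5 = C(t)\<^sup>2 + \<kappa> t\<^sup>2 (1 - t)\<close>, so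
  \<open>T = \<kappa> t\<^sup>2 (1 - t) / ((1 - x t) (1 - r t)\<^sup>5)\<close> is a rational function of degree 6 that is
  ramified outside the zeros and poles of \<open>t (1 - t) (1 - x t)\<close> exactly so that the differential
  \<open>T\<^sup>-\<^sup>7\<^sup>/\<^sup>1\<^sup>0 (1 - T)\<^sup>-\<^sup>1\<^sup>/\<^sup>2 dT\<close> pulls back to a multiple of the Euler integrand
  \<open>t\<^sup>-\<^sup>2\<^sup>/\<^sup>5 (1 - t)\<^sup>-\<^sup>7\<^sup>/\<^sup>1\<^sup>0 (1 - x t)\<^sup>-\<^sup>4\<^sup>/\<^sup>5 dt\<close>. This turns the Euler integral into a beta integral,
  and the remaining gamma quotient is algebraic by the duplication and reflection formulas.
  To have a single monotone substitution on \<open>[0, 1]\<close>, the proof uses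
  \<open>s = (1 - C / sqrt (C\<^sup>2 + \<kappa> t\<^sup>2 (1 - t))) / 2\<close>, for which \<open>4 s (1 - s) = T\<close>.
\<close>

section \<open>Euler's integral for the hypergeometric series\<close>

lemma Beta_add_of_nat_left:
  fixes a b :: real
  assumes "a > 0" "b > 0"
  shows "Beta (a + of_nat n) b = Beta a b * pochhammer a n / pochhammer (a + b) n"
proof (induction n)
  case (Suc n)
  have pos: "a + of_nat n > 0" "a + b + of_nat n > 0"
    using assms by simp_all
  have "(a + of_nat n + b) * Beta (a + of_nat n + 1) b = (a + of_nat n) * Beta (a + of_nat n) b"
    by (rule Beta_plus1_left) (use pos in \<open>auto elim!: nonpos_Ints_cases\<close>)
  hence "Beta (a + of_nat (Suc n)) b = (a + of_nat n) * Beta (a + of_nat n) b / (a + b + of_nat n)"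
    using pos by (simp add: field_simps)
  with Suc show ?case
    by (simp add: pochhammer_Suc)
qed simp

text \<open>With nonnegative integrals, neither the exchange of series and integral nor the later
  substitution calls for an integrability proof.\<close>

lemma nn_integral_Beta:
  fixes a b :: real
  assumes "a > 0" "b > 0"
  shows "(\<integral>\<^sup>+t. ennreal (t powr (a - 1) * (1 - t) powr (b - 1)) * indicator {0..1} t \<partial>lborel) =
           ennreal (Beta a b)"
proof -
  have "ennreal (Beta a b) =
          (\<integral>\<^sup>+t. ennreal (indicator {0..1} t * (t powr (a - 1) * (1 - t) powr (b - 1))) \<partial>lborel)"
    by (rule nn_integral_has_integral_lebesgue[symmetric, OF _ has_integral_Beta_real[OF assms]])
       simp
  also have "\<dots> = (\<integral>\<^sup>+t. ennreal (t powr (a - 1) * (1 - t) powr (b - 1)) * indicator {0..1} t \<partial>lborel)"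
    by (intro nn_integral_cong) (auto simp: indicator_def)
  finally show ?thesis ..
qed

lemma negative_binomial_sums:
  fixes b z :: real
  assumes "\<bar>z\<bar> < 1"
  shows "(\<lambda>n. pochhammer b n / fact n * z ^ n) sums (1 - z) powr (- b)"
proof -
  have "((- b) gchoose n) * (- z) ^ n = pochhammer b n / fact n * z ^ n" for n
    by (simp add: gbinomial_pochhammer power_mult_distrib[of "-1" z, simplified]
        flip: power_add mult_2 power_mult)
  with gen_binomial_real[of "- z" "- b"] assms show ?thesis
    by simp
qed

text \<open>The factor \<open>(1 - x * t) powr (- b)\<close> is expanded by the binomial series and
  integrated termwise against the beta weight, whose moments are quotients of Pochhammer symbols.
  Since \<open>b\<close> and \<open>x\<close> are nonnegative, so are all terms, and monotone
  convergence applies. Convergence of the real series is then read off from the finite value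
  \<open>J\<close>.\<close>

lemma Euler_integral_sums:
  fixes a b c x J :: real
  assumes "0 < a" "a < c" "0 \<le> b" "0 \<le> x" "x < 1" "0 \<le> J"
    and J: "(\<integral>\<^sup>+t. ennreal (t powr (a - 1) * (1 - t) powr (c - a - 1) * (1 - x * t) powr (- b)) *
              indicator {0..1} t \<partial>lborel) = ennreal J"
  shows "(\<lambda>n. pochhammer a n * pochhammer b n / (pochhammer c n * fact n) * x ^ n)
           sums (J / Beta a (c - a))"
proof -
  define w where "w = (\<lambda>t. t powr (a - 1) * (1 - t) powr (c - a - 1))"
  define q where "q = (\<lambda>n. pochhammer b n / fact n * x ^ n)"
  have q_nonneg: "q n \<ge> 0" for n
    proof -
    have "pochhammer b n \<ge> 0"
      using assms by (auto simp: pochhammer_prod intro!: prod_nonneg)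
    thus ?thesis
      using assms by (simp add: q_def)
  qed
  have Beta_pos: "Beta a (c - a) > 0"
    using assms by (simp add: Beta_def Gamma_real_pos)
  have w_meas [measurable]: "w \<in> borel_measurable borel"
    unfolding w_def by measurable
  have expand: "ennreal (w t * (1 - x * t) powr (- b)) * indicator {0..1} t =
                  (\<Sum>n. ennreal (q n) * (ennreal (w t * t ^ n) * indicator {0..1} t))" for t
  proof (cases "t \<in> {0..1}")
    case True
    have w_nonneg: "w t \<ge> 0"
      by (simp add: w_def)
    have "x * t \<le> x * 1"
      using True assms by (intro mult_left_mono) auto
    hence "\<bar>x * t\<bar> < 1"
      using True assms by simp
    hence "(\<lambda>n. w t * (pochhammer b n / fact n * (x * t) ^ n)) sums (w t * (1 - x * t) powr (- b))"
      by (intro sums_mult negative_binomial_sums)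
    hence "(\<lambda>n. q n * (w t * t ^ n)) sums (w t * (1 - x * t) powr (- b))"
      by (simp add: q_def power_mult_distrib mult_ac)
    hence "(\<lambda>n. ennreal (q n * (w t * t ^ n))) sums ennreal (w t * (1 - x * t) powr (- b))"
      using True w_nonneg q_nonneg by (subst sums_ennreal) auto
    thus ?thesis
      using True w_nonneg q_nonneg by (simp add: sums_iff ennreal_mult)
  qed simp
  have moment: "(\<integral>\<^sup>+t. ennreal (w t * t ^ n) * indicator {0..1} t \<partial>lborel) =
                  ennreal (Beta a (c - a) * pochhammer a n / pochhammer c n)" for n
  proof -
    have "(\<integral>\<^sup>+t. ennreal (w t * t ^ n) * indicator {0..1} t \<partial>lborel) =
          (\<integral>\<^sup>+t. ennreal (t powr (a + n - 1) * (1 - t) powr (c - a - 1)) * indicator {0..1} t \<partial>lborel)"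
    proof (intro nn_integral_cong_AE)
      show "AE t in lborel. ennreal (w t * t ^ n) * indicator {0..1} t =
              ennreal (t powr (a + n - 1) * (1 - t) powr (c - a - 1)) * indicator {0..1} t"
        using AE_lborel_singleton[of "0 :: real"]
      proof eventually_elim
        case (elim t)
        show ?case
        proof (cases "t \<in> {0..1}")
          case True
          with elim have "t powr (a + n - 1) = t powr (a - 1) * t ^ n"
            by (simp add: powr_add[symmetric] algebra_simps flip: powr_realpow)
          thus ?thesis
            by (simp add: w_def mult_ac)
        qed simp
      qed
    qed
    also have "\<dots> = ennreal (Beta (a + n) (c - a))"
      using assms by (intro nn_integral_Beta) auto
    also have "Beta (a + n) (c - a) = Beta a (c - a) * pochhammer a n / pochhammer c n"
      using assms by (subst Beta_add_of_nat_left) auto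
    finally show ?thesis .
  qed
  have "ennreal J = (\<integral>\<^sup>+t. (\<Sum>n. ennreal (q n) * (ennreal (w t * t ^ n) * indicator {0..1} t)) \<partial>lborel)"
    unfolding expand[symmetric] by (simp add: J w_def)
  also have "\<dots> = (\<Sum>n. ennreal (q n) * (\<integral>\<^sup>+t. ennreal (w t * t ^ n) * indicator {0..1} t \<partial>lborel))"
    by (subst nn_integral_suminf) (auto simp: nn_integral_cmult)
  also have "\<dots> = (\<Sum>n. ennreal (q n * (Beta a (c - a) * pochhammer a n / pochhammer c n)))"
    by (simp only: moment ennreal_mult'[OF q_nonneg])
  finally have "(\<lambda>n. ennreal (q n * (Beta a (c - a) * pochhammer a n / pochhammer c n))) sums ennreal J"
    by (simp add: sums_iff)
  hence "(\<lambda>n. q n * (Beta a (c - a) * pochhammer a n / pochhammer c n)) sums J"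
    using assms q_nonneg Beta_pos
    by (subst (asm) sums_ennreal)
       (auto intro!: mult_nonneg_nonneg divide_nonneg_nonneg pochhammer_nonneg)
  from sums_divide[OF this, of "Beta a (c - a)"] show ?thesis
    using Beta_pos by (simp add: q_def mult_ac)
qed

section \<open>Gamma identities and the beta quotient\<close>

lemma Gamma_legendre_duplication_real:
  fixes x :: real
  assumes "x > 0"
  shows "Gamma x * Gamma (x + 1 / 2) = 2 powr (1 - 2 * x) * sqrt pi * Gamma (2 * x)"
proof -
  have "complex_of_real (Gamma x * Gamma (x + 1 / 2)) =
          Gamma (of_real x) * Gamma (of_real x + 1 / 2)"
    by (simp flip: Gamma_complex_of_real)
  also have "\<dots> = exp ((1 - 2 * of_real x) * of_real (ln 2)) * of_real (sqrt pi) * Gamma (2 * of_real x)"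
  proof (rule Gamma_legendre_duplication)
    show "complex_of_real x \<notin> \<int>\<^sub>\<le>\<^sub>0"
      using assms by (subst of_real_in_nonpos_Ints_iff) (auto elim!: nonpos_Ints_cases)
    have "complex_of_real (x + 1 / 2) \<notin> \<int>\<^sub>\<le>\<^sub>0"
      using assms by (subst of_real_in_nonpos_Ints_iff) (auto elim!: nonpos_Ints_cases)
    thus "complex_of_real x + 1 / 2 \<notin> \<int>\<^sub>\<le>\<^sub>0"
      by simp
  qed
  also have "\<dots> = complex_of_real (2 powr (1 - 2 * x) * sqrt pi * Gamma (2 * x))"
    by (simp add: powr_def exp_of_real[symmetric] flip: Gamma_complex_of_real)
  finally show ?thesis
    by (simp only: of_real_eq_iff)
qed

lemma Gamma_reflection_real:
  fixes x :: real
  shows "Gamma x * Gamma (1 - x) = pi / sin (pi * x)"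
proof -
  have "complex_of_real (Gamma x * Gamma (1 - x)) = of_real (pi / sin (pi * x))"
    using Gamma_reflection_complex[of "of_real x"]
    by (simp flip: Gamma_complex_of_real sin_of_real)
  thus ?thesis
    by (simp only: of_real_eq_iff)
qed

lemma sin_2pi_5: "sin (2 * pi / 5) = sqrt 2 * sqrt (5 + sqrt 5) / 4"
proof -
  define c where "c = cos (2 * pi / 5)"
  \<comment> \<open>The triple and the double of the angle add up to 2 pi. The resulting cubic in
    \<open>c\<close> has the spurious root 1, which is split off; positivity of \<open>c\<close>
    then selects a root of the quadratic.\<close>
  have "cos (3 * (2 * pi / 5)) = cos (2 * (2 * pi / 5))"
    using cos_2pi_minus[of "2 * (2 * pi / 5)"] by (simp add: algebra_simps)
  hence "4 * c ^ 3 - 3 * c = 2 * c ^ 2 - 1"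
    unfolding c_def by (simp only: cos_treble_cos cos_double_cos)
  hence "(c - 1) * (4 * c ^ 2 + 2 * c - 1) = 0"
    by (simp add: algebra_simps power2_eq_square power3_eq_cube)
  moreover have "c < cos 0"
    unfolding c_def by (rule cos_monotone_0_pi) auto
  ultimately have "4 * c ^ 2 + 2 * c - 1 = 0"
    by simp
  hence "(4 * c + 1) ^ 2 = 5"
    by (simp add: power2_eq_square algebra_simps)
  moreover have "c > 0"
    unfolding c_def by (intro cos_gt_zero_pi) (use pi_gt_zero in linarith)+
  ultimately have c_eq: "c = (sqrt 5 - 1) / 4"
    using real_sqrt_unique[of "4 * c + 1" 5] by simp
  have "sin (2 * pi / 5) ^ 2 = 1 - c ^ 2"
    unfolding c_def by (simp add: sin_squared_eq)
  also have "\<dots> = (sqrt 2 * sqrt (5 + sqrt 5) / 4) ^ 2"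
    by (simp add: c_eq power_divide power_mult_distrib power2_diff field_simps)
  finally show ?thesis
    by (subst (asm) power2_eq_iff_nonneg) (auto intro!: sin_ge_zero)
qed

text \<open>The numerator is the beta integral reached by the substitution, the denominator the
  normalisation \<open>Beta a (c - a)\<close>. Duplication at 3/10 and at 2/5 makes Gamma(4/5)
  cancel and leaves Gamma(2/5) Gamma(3/5), to which reflection applies.\<close>

lemma Beta_ratio:
  "Beta (3 / 10) (3 / 10) / Beta (3 / 5) (3 / 10) = 2 powr (3 / 5) * sin (2 * pi / 5)"
proof -
  have nz: "Gamma x \<noteq> 0" if "x > 0" for x :: real
    using Gamma_real_pos[OF that] by simp
  note nz = nz[of "2 / 5"] nz[of "3 / 5"] nz[of "4 / 5"] nz[of "3 / 10"] nz[of "9 / 10"]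
  have "Gamma (3 / 10) * Gamma (4 / 5) = 2 powr (2 / 5) * sqrt pi * Gamma (3 / 5 :: real)"
    using Gamma_legendre_duplication_real[of "3 / 10"] by simp
  hence G3: "Gamma (3 / 10) = 2 powr (2 / 5) * sqrt pi * Gamma (3 / 5 :: real) / Gamma (4 / 5)"
    using nz by (simp add: eq_divide_eq)
  have "Gamma (2 / 5) * Gamma (9 / 10) = 2 powr (1 / 5) * sqrt pi * Gamma (4 / 5 :: real)"
    using Gamma_legendre_duplication_real[of "2 / 5"] by simp
  hence G9: "Gamma (9 / 10) = 2 powr (1 / 5) * sqrt pi * Gamma (4 / 5 :: real) / Gamma (2 / 5)"
    using nz by (simp add: eq_divide_eq mult.commute)
  have refl: "Gamma (2 / 5) * Gamma (3 / 5 :: real) = pi / sin (2 * pi / 5)"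
    using Gamma_reflection_real[of "2 / 5"] by (simp add: mult_ac)
  have "Beta (3 / 10) (3 / 10) / Beta (3 / 5) (3 / 10) =
          Gamma (3 / 10) * Gamma (9 / 10) / Gamma (3 / 5 :: real) ^ 2"
    using nz by (simp add: Beta_def power2_eq_square field_simps)
  also have "\<dots> = (2 powr (2 / 5) * 2 powr (1 / 5)) * (sqrt pi * sqrt pi) /
                   (Gamma (2 / 5) * Gamma (3 / 5 :: real))"
    using nz unfolding G3 G9 by (simp add: power2_eq_square field_simps)
  also have "\<dots> = 2 powr (3 / 5) * sin (2 * pi / 5)"
    by (simp add: refl flip: powr_add)
  finally show ?thesis .
qed

section \<open>The substitution \<open>s\<close> and the evaluation of the Euler integral\<close>

context
  fixes C P s s' :: "real \<Rightarrow> real" and \<kappa> :: real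
  defines "\<kappa> \<equiv> 84375 / 65536"
  defines "C \<equiv> (\<lambda>t. 1 - 243 / 256 * t - 189 / 512 * t ^ 2 + 27 / 2048 * t ^ 3)"
  defines "P \<equiv> (\<lambda>t. (1 - 3 / 128 * t) * (1 - 3 / 8 * t) ^ 5)"
  defines "s \<equiv> (\<lambda>t. (1 - C t / sqrt (P t)) / 2)"
  defines "s' \<equiv> (\<lambda>t. \<kappa> * t * (1 - 3 / 8 * t) ^ 4 / (2 * P t * sqrt (P t)))"
begin

text \<open>In P - C^2 the coefficients of t^0, t^1, t^4, t^5, t^6 and the value at 1 must vanish:
  six conditions on six unknowns, namely the four coefficients of \<open>C\<close> and the numbers
  3/128 and 3/8.\<close>

private lemma P_eq: "P t = C t ^ 2 + \<kappa> * t ^ 2 * (1 - t)"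
  unfolding P_def C_def \<kappa>_def by algebra

private lemma P_pos: "t \<in> {0..1} \<Longrightarrow> P t > 0"
  unfolding P_def by (intro mult_pos_pos zero_less_power) auto

private lemma s_0: "s 0 = 0"
  by (simp add: s_def C_def P_def)

text \<open>The sign change of \<open>C\<close> matters here: \<open>s\<close> passes 1/2 at a zero
  of \<open>C\<close> and goes on to 1, whereas T = 4 s (1 - s) reaches 1 there and returns to
  0.\<close>

private lemma s_1: "s 1 = 1"
proof -
  have "P 1 = (- C 1) ^ 2"
    by (simp add: P_eq)
  moreover have "C 1 < 0"
    by (simp add: C_def)
  ultimately have "sqrt (P 1) = - C 1"
    by (metis less_eq_real_def neg_0_less_iff_less real_sqrt_unique)
  with \<open>C 1 < 0\<close> show ?thesis
    by (simp add: s_def)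
qed

private lemma s_deriv:
  assumes "t \<in> {0..1}"
  shows "(s has_real_derivative s' t) (at t)"
proof -
  define dC where "dC = - 243 / 256 - 189 / 256 * t + 81 / 2048 * t ^ 2"
  define dP where "dP = - 3 / 128 * (1 - 3 / 8 * t) ^ 5 - 15 / 8 * (1 - 3 / 128 * t) * (1 - 3 / 8 * t) ^ 4"
  have C: "(C has_real_derivative dC) (at t)"
    unfolding C_def dC_def by (auto intro!: derivative_eq_intros simp: field_simps)
  have P: "(P has_real_derivative dP) (at t)"
    unfolding P_def dP_def by (auto intro!: derivative_eq_intros simp: field_simps)
  have pos: "P t > 0"
    using assms by (rule P_pos)
  have sq: "((\<lambda>t. sqrt (P t)) has_real_derivative (dP * inverse (sqrt (P t)) / 2)) (at t)"
    by (rule DERIV_chain'[OF P, THEN DERIV_cong]) (rule DERIV_real_sqrt, fact pos, simp)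
  \<comment> \<open>With Q = P - C^2 the left side equals C' Q - C Q' / 2, so it has degree at most
    5 and is divisible by t. The fivefold root of \<open>P\<close> contributes the fourth power, so
    only a constant factor is left.\<close>
  have key: "dC * P t - C t * dP / 2 = - \<kappa> * t * (1 - 3 / 8 * t) ^ 4"
    unfolding dC_def dP_def C_def P_def \<kappa>_def by algebra
  have "(s has_real_derivative
          (0 - (dC * sqrt (P t) - C t * (dP * inverse (sqrt (P t)) / 2)) / (sqrt (P t) * sqrt (P t))) / 2) (at t)"
    unfolding s_def by (intro DERIV_cdivide DERIV_diff DERIV_const DERIV_divide C sq) (use pos in auto)
  also have "(0 - (dC * sqrt (P t) - C t * (dP * inverse (sqrt (P t)) / 2)) / (sqrt (P t) * sqrt (P t))) / 2
      = - (dC * (sqrt (P t) * sqrt (P t)) - C t * dP / 2) / (2 * P t * sqrt (P t))"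
    using pos by (simp add: field_simps)
  also have "\<dots> = s' t"
    using pos key by (simp add: s'_def)
  finally show ?thesis .
qed

text \<open>The power -7/10 of s (1 - s) yields t^(-7/5) (1 - t)^(-7/10) P^(7/10), and
  \<open>s'\<close> supplies t (1 - 3/8 t)^4 P^(-3/2), up to constants.\<close>

private lemma s_pullback:
  assumes "t \<in> {0..1}"
  shows "s t powr (- 7 / 10) * (1 - s t) powr (- 7 / 10) * s' t =
           (\<kappa> / 4) powr (- 7 / 10) * \<kappa> / 2 *
             (t powr (- 2 / 5) * (1 - t) powr (- 3 / 10 - 2 / 5) * (1 - 3 / 128 * t) powr (- 4 / 5))"
proof (cases "t = 0")
  case False
  define u where "u = 1 - 3 / 8 * t"
  define v where "v = 1 - 3 / 128 * t"
  have t: "t > 0" "t \<le> 1"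
    using assms False by auto
  have pos: "P t > 0" "u > 0" "v > 0"
    using assms P_pos by (auto simp: u_def v_def)
  have P: "P t = v * u ^ 5"
    by (simp add: P_def u_def v_def)
  have \<kappa>: "\<kappa> > 0"
    by (simp add: \<kappa>_def)
  have prod: "s t * (1 - s t) = \<kappa> / 4 * (t ^ 2 * (1 - t) / P t)"
  proof -
    have "s t * (1 - s t) = (1 - C t ^ 2 / P t) / 4"
      using pos by (simp add: s_def field_simps power2_eq_square)
    also have "1 - C t ^ 2 / P t = \<kappa> * t ^ 2 * (1 - t) / P t"
      using pos P_eq[of t] by (simp add: field_simps)
    finally show ?thesis
      by simp
  qed
  have s_range: "s t \<ge> 0" "1 - s t \<ge> 0"
  proof -
    have "C t ^ 2 \<le> P t"
      using t \<kappa> by (simp add: P_eq)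
    hence "\<bar>C t\<bar> \<le> sqrt (P t)"
      by (metis real_sqrt_abs real_sqrt_le_iff)
    hence "\<bar>C t / sqrt (P t)\<bar> \<le> 1"
      using pos by (simp add: abs_divide)
    hence "- 1 \<le> C t / sqrt (P t)" "C t / sqrt (P t) \<le> 1"
      by (simp_all only: abs_le_iff, linarith)
    thus "s t \<ge> 0" "1 - s t \<ge> 0"
      by (simp_all add: s_def)
  qed
  \<comment> \<open>As 7/10 - 3/2 = -4/5, the fivefold factor of \<open>P\<close> enters as u^(-4)
    and cancels against \<open>s'\<close>.\<close>
  have pw: "(v * u ^ 5) powr (7 / 10) / (v * u ^ 5 * sqrt (v * u ^ 5)) * u ^ 4 = v powr (- 4 / 5)"
  proof -
    have "v * u ^ 5 * sqrt (v * u ^ 5) = (v * u ^ 5) powr (3 / 2)"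
      using pos powr_add[of "v * u ^ 5" 1 "1 / 2"] by (simp add: powr_half_sqrt)
    hence "(v * u ^ 5) powr (7 / 10) / (v * u ^ 5 * sqrt (v * u ^ 5)) = (v * u ^ 5) powr (- 4 / 5)"
      by (simp flip: powr_diff)
    also have "\<dots> = v powr (- 4 / 5) * (u powr 5) powr (- 4 / 5)"
      using pos by (simp add: powr_mult)
    also have "(u powr 5) powr (- 4 / 5) = u powr (- 4)"
      by (simp add: powr_powr)
    finally have *: "(v * u ^ 5) powr (7 / 10) / (v * u ^ 5 * sqrt (v * u ^ 5)) =
        v powr (- 4 / 5) * u powr (- 4)" .
    have "u powr (- 4) * u ^ 4 = 1"
      using pos powr_add[of u "-4" 4] by simp
    thus ?thesis
      unfolding * by (simp add: mult.assoc)
  qed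
  have "s t powr (- 7 / 10) * (1 - s t) powr (- 7 / 10) = (s t * (1 - s t)) powr (- 7 / 10)"
    using s_range by (simp add: powr_mult)
  also have "\<dots> = (\<kappa> / 4) powr (- 7 / 10) * ((t ^ 2) powr (- 7 / 10) * (1 - t) powr (- 7 / 10) *
                     P t powr (7 / 10))"
  proof -
    have "(\<kappa> / 4 * (t ^ 2 * (1 - t) / P t)) powr (- 7 / 10) =
            (\<kappa> / 4) powr (- 7 / 10) * (t ^ 2 * (1 - t) / P t) powr (- 7 / 10)"
      by (rule powr_mult)
    also have "(t ^ 2 * (1 - t) / P t) powr (- 7 / 10) =
                 (t ^ 2 * (1 - t)) powr (- 7 / 10) / P t powr (- 7 / 10)"
      by (rule powr_divide)
    also have "(t ^ 2 * (1 - t)) powr (- 7 / 10) = (t ^ 2) powr (- 7 / 10) * (1 - t) powr (- 7 / 10)"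
      by (rule powr_mult)
    also have "X / P t powr (- 7 / 10) = X * P t powr (7 / 10)" for X
      using powr_minus_divide[of "P t" "7 / 10"] by simp
    finally show ?thesis
      unfolding prod by (simp only: mult.assoc)
  qed
  also have "(t ^ 2) powr (- 7 / 10) = t powr (- 7 / 5)"
    using t powr_powr[of t 2 "- 7 / 10"] by simp
  finally have eq: "s t powr (- 7 / 10) * (1 - s t) powr (- 7 / 10) = (\<kappa> / 4) powr (- 7 / 10) *
      (t powr (- 7 / 5) * (1 - t) powr (- 7 / 10) * P t powr (7 / 10))" .
  have t_eq: "t powr (- 7 / 5) * t = t powr (- 2 / 5)"
    using t powr_add[of t "- 7 / 5" 1] by simp
  have "s t powr (- 7 / 10) * (1 - s t) powr (- 7 / 10) * s' t =
          (\<kappa> / 4) powr (- 7 / 10) * \<kappa> / 2 * ((t powr (- 7 / 5) * t) * (1 - t) powr (- 7 / 10) *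
            ((v * u ^ 5) powr (7 / 10) / (v * u ^ 5 * sqrt (v * u ^ 5)) * u ^ 4))"
    unfolding eq s'_def P u_def[symmetric] by (simp add: mult_ac)
  thus ?thesis
    unfolding pw t_eq by (simp add: v_def)
\<comment> \<open>At t = 0 both sides are 0, because \<open>0 powr y\<close> is 0 for every
  \<open>y\<close>.\<close>
qed (simp add: s_0)

text \<open>The exponents are kept in the shape that \<open>Euler_integral_sums\<close> expects for
  a = 3/5, b = 4/5, c = 9/10. The two fractions are \<kappa>/4 and \<kappa>/2, from
  \<open>s_pullback\<close>.\<close>

lemma nn_integral_Euler_integrand:
  "(\<integral>\<^sup>+t. ennreal (t powr (3 / 5 - 1) * (1 - t) powr (9 / 10 - 3 / 5 - 1) *
       (1 - 3 / 128 * t) powr (- (4 / 5))) * indicator {0..1} t \<partial>lborel) =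
     ennreal (Beta (3 / 10) (3 / 10) / ((84375 / 262144) powr (- 7 / 10) * (84375 / 131072)))"
proof -
  define E where "E = (\<lambda>t::real. t powr (3 / 5 - 1) * (1 - t) powr (9 / 10 - 3 / 5 - 1) *
       (1 - 3 / 128 * t) powr (- (4 / 5)))"
  define f where "f = (\<lambda>y::real. y powr (3 / 10 - 1) * (1 - y) powr (3 / 10 - 1))"
  define k where "k = (84375 / 262144) powr (- 7 / 10) * (84375 / 131072 :: real)"
  have k: "k > 0"
    by (simp add: k_def)
  have E_nonneg: "E t \<ge> 0" for t
    by (simp add: E_def)
  have [measurable]: "E \<in> borel_measurable borel" "f \<in> borel_measurable borel"
    unfolding E_def f_def by measurable
  have "ennreal (Beta (3 / 10) (3 / 10)) = (\<integral>\<^sup>+y. ennreal (f y * indicator {s 0..s 1} y) \<partial>lborel)"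
    unfolding s_0 s_1 using nn_integral_Beta[of "3 / 10" "3 / 10"]
    by (simp add: f_def ennreal_mult' ennreal_indicator)
  also have "\<dots> = (\<integral>\<^sup>+t. ennreal (f (s t) * s' t * indicator {0..1} t) \<partial>lborel)"
  proof (rule nn_integral_substitution)
    show "set_borel_measurable borel {s 0..s 1} f"
      unfolding set_borel_measurable_def by measurable
    show "continuous_on {0..1} s'"
      unfolding s'_def P_def
      by (intro continuous_intros) (use P_pos in \<open>force simp: P_def\<close>)
    show "s' t \<ge> 0" if "t \<in> {0..1}" for t
      using that P_pos[OF that] by (auto simp: s'_def \<kappa>_def)
  qed (auto intro: s_deriv)
  also have "\<dots> = (\<integral>\<^sup>+t. ennreal k * (ennreal (E t) * indicator {0..1} t) \<partial>lborel)"
  proof (intro nn_integral_cong)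
    fix t :: real
    show "ennreal (f (s t) * s' t * indicator {0..1} t) = ennreal k * (ennreal (E t) * indicator {0..1} t)"
    proof (cases "t \<in> {0..1}")
      case True
      have "f (s t) * s' t = k * E t"
        using s_pullback[OF True] by (simp add: f_def E_def k_def \<kappa>_def)
      thus ?thesis
        using True k E_nonneg by (simp add: ennreal_mult)
    qed simp
  qed
  also have "\<dots> = ennreal k * (\<integral>\<^sup>+t. ennreal (E t) * indicator {0..1} t \<partial>lborel)"
    by (rule nn_integral_cmult) measurable
  finally have "(\<integral>\<^sup>+t. ennreal (E t) * indicator {0..1} t \<partial>lborel) =
      ennreal (Beta (3 / 10) (3 / 10)) / ennreal k"
    using k by (simp add: ennreal_mult_divide_eq mult.commute[of "ennreal k"])
  also have "\<dots> = ennreal (Beta (3 / 10) (3 / 10) / k)"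
    using k by (intro divide_ennreal) (simp_all add: Beta_def Gamma_real_pos less_imp_le)
  finally show ?thesis
    unfolding E_def k_def .
qed

end

section \<open>The algebraic constant and the final evaluation\<close>

lemma scaling_constant_eq:
  "2 powr (3 / 5) / ((84375 / 262144) powr (- 7 / 10) * (84375 / 131072)) =
     32 / 75 * root 10 3 * sqrt (5 :: real)"
proof -
  \<comment> \<open>Only the primes 2, 3, 5 occur, so taking logarithms reduces the claim to
    comparing exponents; on both sides they are 5, -9/10 and -3/2.\<close>
  have "ln (2 powr (3 / 5) / ((84375 / 262144) powr (- 7 / 10) * (84375 / 131072))) =
        ln (32 / 75 * 3 powr (1 / 10) * 5 powr (1 / 2) :: real)"
  proof -
    have *: "ln (84375 :: real) = 3 * ln 3 + 5 * ln 5" "ln (262144 :: real) = 18 * ln 2"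
      "ln (131072 :: real) = 17 * ln 2" "ln (32 :: real) = 5 * ln 2" "ln (75 :: real) = ln 3 + 2 * ln 5"
      using ln_mult[of "3 ^ 3" "5 ^ 5 :: real"] ln_mult[of 3 "5 ^ 2 :: real"]
        ln_realpow[of 3 3] ln_realpow[of 5 5] ln_realpow[of 2 18] ln_realpow[of 2 17]
        ln_realpow[of 2 5] ln_realpow[of 5 2] by simp_all
    show ?thesis
      by (simp add: ln_mult ln_div ln_powr * algebra_simps)
  qed
  hence "2 powr (3 / 5) / ((84375 / 262144) powr (- 7 / 10) * (84375 / 131072)) =
         32 / 75 * 3 powr (1 / 10) * (5 :: real) powr (1 / 2)"
    by (subst (asm) ln_inj_iff) auto
  thus ?thesis
    by (simp add: root_powr_inverse powr_half_sqrt)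
qed

theorem mainTheorem2:
  shows "hyp2F1 (3 / 5) (4 / 5) (9 / 10) (3 / 128) =
    complex_of_real (8 / 75 * sqrt 2 * root 10 3 * sqrt 5 * sqrt (5 + sqrt 5))"
proof -
  define k where "k = (84375 / 262144) powr (- 7 / 10) * (84375 / 131072 :: real)"
  define a where "a = (\<lambda>n. pochhammer (3 / 5) n * pochhammer (4 / 5) n /
                          (pochhammer (9 / 10) n * fact n) * (3 / 128 :: real) ^ n)"
  have "a sums (Beta (3 / 10) (3 / 10) / k / Beta (3 / 5) (9 / 10 - 3 / 5))"
    unfolding a_def
  proof (rule Euler_integral_sums)
    show "0 \<le> Beta (3 / 10) (3 / 10) / k"
      by (simp add: k_def Beta_def Gamma_real_pos less_imp_le)
  qed (use nn_integral_Euler_integrand in \<open>simp_all add: k_def\<close>)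
  also have "Beta (3 / 10) (3 / 10) / k / Beta (3 / 5) (9 / 10 - 3 / 5) =
               Beta (3 / 10) (3 / 10) / Beta (3 / 5) (3 / 10) / k"
    by simp
  also have "\<dots> = 2 powr (3 / 5) / k * sin (2 * pi / 5)"
    by (simp add: Beta_ratio)
  \<comment> \<open>The denominator 4 of the sine turns 32/75 into 8/75.\<close>
  also have "\<dots> = 8 / 75 * sqrt 2 * root 10 3 * sqrt 5 * sqrt (5 + sqrt 5)"
    unfolding k_def scaling_constant_eq sin_2pi_5 by simp
  finally have "(\<lambda>n. complex_of_real (a n)) sums
      complex_of_real (8 / 75 * sqrt 2 * root 10 3 * sqrt 5 * sqrt (5 + sqrt 5))"
    by (rule sums_of_real)
  moreover have "complex_of_real (a n) = pochhammer (3 / 5) n * pochhammer (4 / 5) n /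
      (pochhammer (9 / 10) n * pochhammer 1 n) * (3 / 128) ^ n" for n
    unfolding a_def by (simp add: pochhammer_of_real[symmetric] flip: pochhammer_fact)
  ultimately show ?thesis
    by (simp add: hyp2F1_def sums_iff)
qed

end
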